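(* For every $u\ge0$, the random set $\mathcal{I}^{u,L}$ converges in distribution to $\mathcal{I}^u$ as $L\to\infty$, in the sense of convergence in law of all finite-dimensional marginals (where random subsets of $\mathbb{Z}^d$ are viewed as $\{0,1\}^{\mathbb{Z}^d}$-valued random variables and $\{0,1\}^{\mathbb{Z}^d}$ carries the product topology).
   Context: Fix $d\ge 3$. $P_x$ is the law of the discrete-time lazy simple random walk $X=(X_n)_{n\ge0}$ on $\mathbb{Z}^d$ started at $x$: at each step it stays put with probability $1/2$ and jumps to each of the $2d$ nearest neighbors with probability $1/(4d)$. Finite range interlacements: let $W_+$ be the space of $\mathbb{Z}^d$-valued trajectories $(w(n))_{n\ge0}$ and $\eta=\sum_i\delta_{(w_i,u_i)}$ a Poisson point process on $W_+\times\mathbb{R}_+$ with intensity $\nu(A\times[0,v])=v\sum_{x\in\mathbb{Z}^d}P_x[X\in A]$. For $u\ge0$ and an integer $L\ge1$, $\mathcal{I}^{u,L}=\bigcup_{i:\,u_i\le4du/L}\{w_i(0),\dots,w_i(L-1)\}$. Random interlacements: $\mathcal{I}^u\subset\mathbb{Z}^d$ is the interlacement set at level $u$, i.e. the union of ranges of the trajectories with label at most $u$ in the Poisson cloud of bi-infinite (lazy) random walk trajectories modulo time-shift with labels in $\mathbb{R}_+$, on $\mathbb{Z}^d$ with weights $a_{x,y}=1$ for nearest neighbors $x,y$, $a_{x,x}=2d$ (so $a_x=4d$). Its law is characterized by $\mathbb{P}[\mathcal{I}^u\cap K=\emptyset]=e^{-u\,\mathrm{cap}(K)}$ for all finite $K\subset\mathbb{Z}^d$,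 where $\mathrm{cap}(K)=\sum_{x\in K}4d\,P_x[\widetilde{H}_K=\infty]$ and $\widetilde{H}_K=\inf\{n\ge1:X_n\in K\}$. *)

theory Defs
  imports "HOL-Probability.Probability"
begin

section \<open>The lazy simple random walk on \<open>\<int>\<^sup>d\<close>\<close>

text \<open>The lattice \<open>\<int>\<^sup>d\<close> is the type \<open>int ^ 'd\<close>, so that \<open>d = CARD('d)\<close>.\<close>

definition unit_steps :: "(int ^ 'd) set" where
  "unit_steps = (\<Union>i. {axis i 1, - axis i 1})"

definition lazy_step :: "(int ^ 'd) pmf" where
  "lazy_step =
     bind_pmf (bernoulli_pmf (1 / 2)) (\<lambda>stay. if stay then return_pmf 0 else pmf_of_set unit_steps)"

definition path_space :: "(nat \<Rightarrow> int ^ 'd) measure" where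
  "path_space = (\<Pi>\<^sub>M n\<in>UNIV. count_space UNIV)"

definition lazy_walk :: "int ^ 'd \<Rightarrow> (nat \<Rightarrow> int ^ 'd) measure" where
  "lazy_walk x =
     distr (\<Pi>\<^sub>M n\<in>UNIV. measure_pmf lazy_step) path_space (\<lambda>\<xi> n. x + (\<Sum>k<n. \<xi> k))"

lemma finite_unit_steps: "finite (unit_steps :: (int ^ 'd) set)"
  by (simp add: unit_steps_def)

lemma unit_steps_nonempty: "(unit_steps :: (int ^ 'd) set) \<noteq> {}"
  by (simp add: unit_steps_def)

lemma card_unit_steps: "card (unit_steps :: (int ^ 'd) set) = 2 * CARD('d)"
proof -
  have ax: "axis i (1::int) = axis j 1 \<longleftrightarrow> i = j" for i j :: 'd
    by (simp add: axis_eq_axis)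
  have ax': "axis i (1::int) \<noteq> - axis j 1" for i j :: 'd
  proof
    assume "axis i (1::int) = - axis j 1"
    then have "axis i (1::int) $ i = (- axis j 1) $ i" by simp
    then show False by (auto simp: axis_def split: if_splits)
  qed
  have "card (unit_steps :: (int ^ 'd) set) = (\<Sum>i\<in>(UNIV::'d set). card {axis i (1::int), - axis i 1})"
    unfolding unit_steps_def using ax ax' ax'[symmetric]
    by (intro card_UN_disjoint) (auto)
  also have "\<dots> = (\<Sum>i\<in>(UNIV::'d set). 2)"
    using ax' by (intro sum.cong) auto
  finally show ?thesis by simp
qed

lemma pmf_lazy_step:
  "pmf (lazy_step :: (int ^ 'd) pmf) e =
     (if e = 0 then 1 / 2 else if e \<in> unit_steps then 1 / (4 * real CARD('d)) else 0)"
proof -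
  have "(0 :: int ^ 'd) \<notin> unit_steps"
    by (auto simp: unit_steps_def axis_def vec_eq_iff)
  then show ?thesis
    by (auto simp: lazy_step_def pmf_bind pmf_of_set[OF unit_steps_nonempty finite_unit_steps]
        card_unit_steps indicator_def)
qed

lemma space_path_space [simp]: "space path_space = UNIV"
  by (simp add: path_space_def space_PiM)

lemma measurable_path_component [measurable]: "(\<lambda>w. w n) \<in> path_space \<rightarrow>\<^sub>M count_space UNIV"
  unfolding path_space_def by simp

lemma sets_lazy_walk [simp, measurable_cong]: "sets (lazy_walk x) = sets path_space"
  by (simp add: lazy_walk_def)

lemma space_lazy_walk [simp]: "space (lazy_walk x) = UNIV"
  by (simp add: lazy_walk_def)

lemma measurable_partial_sums [measurable]:
  "(\<lambda>\<xi> n. x + (\<Sum>k<n. \<xi> k)) \<in>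
     (\<Pi>\<^sub>M n\<in>(UNIV::nat set). measure_pmf (lazy_step :: (int ^ 'd) pmf)) \<rightarrow>\<^sub>M path_space"
proof -
  have "(\<lambda>\<xi>. \<Sum>k<n. \<xi> k) \<in>
     (\<Pi>\<^sub>M n\<in>(UNIV::nat set). measure_pmf (lazy_step :: (int ^ 'd) pmf)) \<rightarrow>\<^sub>M count_space UNIV" for n :: nat
  proof (induction n)
    case (Suc n)
    have "(\<lambda>\<xi>. \<xi> n) \<in>
     (\<Pi>\<^sub>M n\<in>(UNIV::nat set). measure_pmf (lazy_step :: (int ^ 'd) pmf)) \<rightarrow>\<^sub>M count_space UNIV"
      using measurable_component_singleton[of n "UNIV::nat set" "\<lambda>_. measure_pmf (lazy_step :: (int ^ 'd) pmf)"]
      by simp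
    then have "(\<lambda>\<xi>. s + \<xi> n) \<in>
     (\<Pi>\<^sub>M n\<in>(UNIV::nat set). measure_pmf (lazy_step :: (int ^ 'd) pmf)) \<rightarrow>\<^sub>M count_space UNIV" for s
      by (rule measurable_compose) auto
    from measurable_compose_countable[OF this Suc] show ?case
      by (simp add: sum.lessThan_Suc)
  qed simp
  then show ?thesis
    unfolding path_space_def
    by (intro measurable_PiM_single') (auto intro: measurable_compose[of _ _ "count_space UNIV"])
qed

lemma prob_space_lazy_walk: "prob_space (lazy_walk x)"
proof -
  interpret product_prob_space "\<lambda>_. measure_pmf lazy_step" "UNIV :: nat set" ..
  show ?thesis
    unfolding lazy_walk_def by (intro prob_space_distr measurable_partial_sums)
qed


section \<open>Poisson point processes\<close>

text \<open>
  A point process \<open>\<Sum>\<^sub>i \<delta>\<^bsub>p\<^sub>i\<^esub>\<close> is given by a random partial enumeration \<open>\<eta> \<omega> :: nat \<rightharpoonup> 'a\<close> of its points,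
  which allows multiple points and finitely or countably many of them.
\<close>

definition num_points :: "('\<omega> \<Rightarrow> nat \<rightharpoonup> 'a) \<Rightarrow> 'a set \<Rightarrow> '\<omega> \<Rightarrow> ennreal" where
  "num_points \<eta> B \<omega> = emeasure (count_space UNIV) {i. \<exists>p\<in>B. \<eta> \<omega> i = Some p}"

definition poisson_point_process :: "'\<omega> measure \<Rightarrow> 'a measure \<Rightarrow> ('\<omega> \<Rightarrow> nat \<rightharpoonup> 'a) \<Rightarrow> bool" where
  "poisson_point_process M \<mu> \<eta> \<longleftrightarrow>
     prob_space M \<and>
     (\<forall>\<omega>\<in>space M. ran (\<eta> \<omega>) \<subseteq> space \<mu>) \<and>
     (\<forall>B\<in>sets \<mu>. num_points \<eta> B \<in> borel_measurable M) \<and>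
     (\<forall>B\<in>sets \<mu>. emeasure \<mu> B < \<infinity> \<longrightarrow>
        (\<forall>k::nat. measure M {\<omega>\<in>space M. num_points \<eta> B \<omega> = of_nat k} =
           measure \<mu> B ^ k / fact k * exp (- measure \<mu> B))) \<and>
     (\<forall>B\<in>sets \<mu>. emeasure \<mu> B = \<infinity> \<longrightarrow> (AE \<omega> in M. num_points \<eta> B \<omega> = \<infinity>)) \<and>
     (\<forall>\<B>. finite \<B> \<and> \<B> \<subseteq> sets \<mu> \<and> disjoint \<B> \<longrightarrow>
        prob_space.indep_vars M (\<lambda>_. borel) (num_points \<eta>) \<B>)"

abbreviation label_measure :: "real measure" where
  "label_measure \<equiv> restrict_space lborel {0..}"


section \<open>Finite range interlacements\<close>

text \<open>The kernel composition \<open>count_space UNIV \<bind> lazy_walk\<close> is the measure \<open>\<Sum>\<^sub>x P\<^sub>x\<close>.\<close>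

definition finite_range_intensity :: "((nat \<Rightarrow> int ^ 'd) \<times> real) measure" where
  "finite_range_intensity = (count_space UNIV \<bind> lazy_walk) \<Otimes>\<^sub>M label_measure"

lemma lazy_walk_kernel: "lazy_walk \<in> count_space UNIV \<rightarrow>\<^sub>M subprob_algebra path_space"
  by (auto simp: space_subprob_algebra intro!: prob_space_imp_subprob_space prob_space_lazy_walk)

lemma emeasure_bind_lazy_walk:
  assumes "A \<in> sets path_space"
  shows "emeasure (count_space UNIV \<bind> lazy_walk) A =
    (\<integral>\<^sup>+ x. emeasure (lazy_walk x) A \<partial>count_space UNIV)"
  using assms by (subst emeasure_bind[OF _ lazy_walk_kernel]) auto

lemma sets_bind_lazy_walk [simp]: "sets (count_space UNIV \<bind> lazy_walk) = sets path_space"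
  by (rule sets_bind) auto

lemma sigma_finite_label_measure: "sigma_finite_measure label_measure"
  by (rule sigma_finite_measure_restrict_space) (auto intro: lborel.sigma_finite_measure_axioms)

lemma emeasure_label_measure: "v \<ge> 0 \<Longrightarrow> emeasure label_measure {0..v} = ennreal v"
  by (subst emeasure_restrict_space) auto

lemma emeasure_finite_range_intensity:
  assumes "A \<in> sets path_space" "v \<ge> 0"
  shows "emeasure finite_range_intensity (A \<times> {0..v}) =
    ennreal v * (\<integral>\<^sup>+ x. emeasure (lazy_walk x) A \<partial>count_space UNIV)"
proof -
  interpret sigma_finite_measure label_measure by (rule sigma_finite_label_measure)
  have "{0..v} \<in> sets label_measure" by (auto simp: sets_restrict_space_iff)
  with assms show ?thesis
    unfolding finite_range_intensity_def
    by (subst emeasure_pair_measure_Times)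
       (auto simp: emeasure_bind_lazy_walk emeasure_label_measure mult.commute)
qed

definition finite_range_interlacement ::
    "('\<omega> \<Rightarrow> nat \<rightharpoonup> (nat \<Rightarrow> int ^ 'd) \<times> real) \<Rightarrow> real \<Rightarrow> nat \<Rightarrow> '\<omega> \<Rightarrow> (int ^ 'd) set" where
  "finite_range_interlacement \<eta> u L \<omega> =
     \<Union>{w ` {..<L} | w. \<exists>i v. \<eta> \<omega> i = Some (w, v) \<and> v \<le> 4 * real CARD('d) * u / real L}"


section \<open>Random interlacements\<close>

text \<open>
  The edge weights are 1 between nearest neighbours and \<open>2d\<close> on loops, so every vertex has weight \<open>4d\<close>.
\<close>

definition bi_path_space :: "(int \<Rightarrow> int ^ 'd) measure" where
  "bi_path_space = (\<Pi>\<^sub>M n\<in>UNIV. count_space UNIV)"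

definition time_shift :: "((int \<Rightarrow> int ^ 'd) \<times> (int \<Rightarrow> int ^ 'd)) set" where
  "time_shift = {(w, w'). \<exists>k. \<forall>n. w' n = w (n + k)}"

text \<open>
  The measurable sets are those with measurable preimage under the quotient map.
  All bi-infinite trajectories are admitted, not only the nearest-neighbour ones that tend to
  infinity in both time directions: for \<open>d \<ge> 3\<close> the other ones form a null set for the intensity
  measure below.
\<close>

definition traj_space :: "(int \<Rightarrow> int ^ 'd) set measure" where
  "traj_space =
     sigma (UNIV // time_shift)
       {A. A \<subseteq> UNIV // time_shift \<and> {w. time_shift `` {w} \<in> A} \<in> sets bi_path_space}"

definition traj_range :: "(int \<Rightarrow> int ^ 'd) set \<Rightarrow> (int ^ 'd) set" where
  "traj_range c = (\<Union>w\<in>c. range w)"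

definition traj_hitting :: "(int ^ 'd) set \<Rightarrow> (int \<Rightarrow> int ^ 'd) set set" where
  "traj_hitting K = {c \<in> UNIV // time_shift. traj_range c \<inter> K \<noteq> {}}"

definition glue :: "(nat \<Rightarrow> int ^ 'd) \<Rightarrow> (nat \<Rightarrow> int ^ 'd) \<Rightarrow> int \<Rightarrow> int ^ 'd" where
  "glue b f n = (if n \<ge> 0 then f (nat n) else b (nat (- n)))"

text \<open>
  The event that the hitting time \<open>inf {n \<ge> 1. X\<^sub>n \<in> K}\<close> is infinite.
\<close>

definition no_return :: "(int ^ 'd) set \<Rightarrow> (nat \<Rightarrow> int ^ 'd) set" where
  "no_return K = {w. \<forall>n\<ge>1. w n \<notin> K}"

definition capacity :: "(int ^ 'd) set \<Rightarrow> real" where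
  "capacity K = (\<Sum>x\<in>K. 4 * real CARD('d) * measure (lazy_walk x) (no_return K))"

text \<open>
  The measure \<open>Q\<^sub>K\<close> on bi-infinite trajectories that enter \<open>K\<close> for the first time at time 0.
  With the equilibrium measure \<open>e\<^sub>K x = 4d P\<^sub>x[no_return K]\<close> it is given by
  \<open>Q\<^sub>K[(X\<^bsub>-n\<^esub>)\<^bsub>n\<ge>0\<^esub> \<in> A, X\<^sub>0 = x, (X\<^sub>n)\<^bsub>n\<ge>0\<^esub> \<in> B] = e\<^sub>K x * P\<^sub>x[A | no_return K] * P\<^sub>x[B]\<close> for \<open>x \<in> K\<close>;
  the product of the first two factors is \<open>4d P\<^sub>x[A \<inter> no_return K]\<close>.
\<close>

definition entrance_mass :: "(int ^ 'd) set \<Rightarrow> (int \<Rightarrow> int ^ 'd) set \<Rightarrow> ennreal" where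
  "entrance_mass K S =
     (\<Sum>x\<in>K. ennreal (4 * real CARD('d)) *
        emeasure (lazy_walk x \<Otimes>\<^sub>M lazy_walk x) {(b, f). b \<in> no_return K \<and> glue b f \<in> S})"

text \<open>
  The intensity measure on trajectories modulo time-shift is the (unique) one whose restriction to
  the trajectories hitting a finite set \<open>K\<close> is the image of \<open>Q\<^sub>K\<close> under the quotient map.
\<close>

definition interlacement_intensity :: "(int \<Rightarrow> int ^ 'd) set measure \<Rightarrow> bool" where
  "interlacement_intensity \<nu> \<longleftrightarrow>
     sets \<nu> = sets traj_space \<and>
     (\<forall>K. finite K \<longrightarrow> (\<forall>A\<in>sets traj_space.
        emeasure \<nu> (A \<inter> traj_hitting K) = entrance_mass K {w. time_shift `` {w} \<in> A}))"

definition random_interlacement ::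
    "('\<omega> \<Rightarrow> nat \<rightharpoonup> (int \<Rightarrow> int ^ 'd) set \<times> real) \<Rightarrow> real \<Rightarrow> '\<omega> \<Rightarrow> (int ^ 'd) set" where
  "random_interlacement \<eta> u \<omega> = \<Union>{traj_range c | c. \<exists>i v. \<eta> \<omega> i = Some (c, v) \<and> v \<le> u}"

lemma space_bi_path_space [simp]: "space bi_path_space = UNIV"
  by (simp add: bi_path_space_def space_PiM)

lemma measurable_bi_path_component [measurable]:
  "(\<lambda>w. w n) \<in> bi_path_space \<rightarrow>\<^sub>M count_space UNIV"
  unfolding bi_path_space_def by simp

lemma space_traj_space: "space traj_space = UNIV // time_shift"
  unfolding traj_space_def by (rule space_measure_of) auto

lemma sets_traj_space:
  "sets traj_space =
     {A. A \<subseteq> UNIV // time_shift \<and> {w. time_shift `` {w} \<in> A} \<in> sets bi_path_space}"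
proof -
  let ?S = "{A. A \<subseteq> UNIV // time_shift \<and> {w. time_shift `` {w} \<in> A} \<in> sets bi_path_space}"
  have "sigma_algebra (UNIV // time_shift) ?S"
    unfolding sigma_algebra_iff2
  proof (intro conjI ballI allI impI)
    fix A assume "A \<in> ?S"
    then have "UNIV - {w. time_shift `` {w} \<in> A} \<in> sets bi_path_space"
      using sets.compl_sets[of "{w. time_shift `` {w} \<in> A}" bi_path_space] by simp
    also have "UNIV - {w. time_shift `` {w} \<in> A} = {w. time_shift `` {w} \<in> UNIV // time_shift - A}"
      by (auto intro: quotientI)
    finally show "UNIV // time_shift - A \<in> ?S" by auto
  next
    fix A :: "nat \<Rightarrow> _" assume A: "range A \<subseteq> ?S"
    then have "(\<Union>i. {w. time_shift `` {w} \<in> A i}) \<in> sets bi_path_space"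
      by (intro sets.countable_UN) auto
    also have "(\<Union>i. {w. time_shift `` {w} \<in> A i}) = {w. time_shift `` {w} \<in> (\<Union>i. A i)}" by auto
    finally show "(\<Union>i. A i) \<in> ?S" using A by auto
  qed auto
  then show ?thesis
    unfolding traj_space_def using sigma_algebra.sigma_sets_eq by (subst sets_measure_of) blast+
qed

lemma traj_range_class: "traj_range (time_shift `` {w}) = range w"
proof -
  have "w \<in> time_shift `` {w}" by (auto simp: time_shift_def intro: exI[of _ 0])
  then show ?thesis by (fastforce simp: traj_range_def time_shift_def)
qed

lemma traj_hitting_sets: "finite K \<Longrightarrow> traj_hitting K \<in> sets traj_space"
proof -
  have "{w. time_shift `` {w} \<in> traj_hitting K} = {w \<in> space bi_path_space. \<exists>n. w n \<in> K}"
    by (auto simp: traj_hitting_def traj_range_class quotientI)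
  also have "\<dots> \<in> sets bi_path_space" by measurable
  finally show ?thesis by (auto simp: sets_traj_space traj_hitting_def)
qed

lemma measurable_no_return: "no_return K \<in> sets path_space"
proof -
  have "no_return K = {w \<in> space path_space. \<forall>n. n \<ge> 1 \<longrightarrow> w n \<notin> K}"
    by (auto simp: no_return_def)
  also have "\<dots> \<in> sets path_space" by measurable
  finally show ?thesis .
qed

lemma measurable_glue:
  "(\<lambda>(b, f). glue b f) \<in> path_space \<Otimes>\<^sub>M path_space \<rightarrow>\<^sub>M bi_path_space"
proof -
  have "(\<lambda>x. glue (fst x) (snd x) n) \<in> path_space \<Otimes>\<^sub>M path_space \<rightarrow>\<^sub>M count_space UNIV" for n
    unfolding glue_def by (cases "n \<ge> 0") (simp_all, measurable)
  then show ?thesis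
    unfolding bi_path_space_def case_prod_beta by (intro measurable_PiM_single') auto
qed

lemma emeasure_traj_hitting:
  assumes "interlacement_intensity \<nu>" "finite K"
  shows "emeasure \<nu> (traj_hitting K) = ennreal (capacity K)"
proof -
  have "emeasure (lazy_walk x \<Otimes>\<^sub>M lazy_walk x)
      {(b, f). b \<in> no_return K \<and> glue b f \<in> {w. time_shift `` {w} \<in> space traj_space}} =
     ennreal (measure (lazy_walk x) (no_return K))" for x
  proof -
    interpret P: prob_space "lazy_walk x" by (rule prob_space_lazy_walk)
    have "{(b, f). b \<in> no_return K \<and> glue b f \<in> {w. time_shift `` {w} \<in> space traj_space}} =
      no_return K \<times> space (lazy_walk x)"
      by (auto simp: space_traj_space quotientI)
    moreover have "emeasure (lazy_walk x \<Otimes>\<^sub>M lazy_walk x) (no_return K \<times> space (lazy_walk x)) =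
        emeasure (lazy_walk x) (no_return K) * emeasure (lazy_walk x) (space (lazy_walk x))"
      by (intro P.emeasure_pair_measure_Times sets.top) (simp add: measurable_no_return)
    ultimately show ?thesis
      by (simp only: P.emeasure_space_1 mult_1_right) (simp only: P.emeasure_eq_measure)
  qed
  then have "entrance_mass K {w. time_shift `` {w} \<in> space traj_space} = ennreal (capacity K)"
    unfolding entrance_mass_def capacity_def
    by (simp add: ennreal_mult'[symmetric] sum_nonneg)
  moreover have "space traj_space \<inter> traj_hitting K = traj_hitting K"
    by (auto simp: space_traj_space traj_hitting_def)
  ultimately show ?thesis
    using assms unfolding interlacement_intensity_def by (metis sets.top)
qed

lemma random_interlacement_void_probability:
  assumes "interlacement_intensity \<nu>" "poisson_point_process M (\<nu> \<Otimes>\<^sub>M label_measure) \<eta>"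
    and "u \<ge> 0" "finite K"
  shows "measure M {\<omega>\<in>space M. random_interlacement \<eta> u \<omega> \<inter> K = {}} = exp (- u * capacity K)"
proof -
  let ?\<mu> = "\<nu> \<Otimes>\<^sub>M label_measure"
  let ?B = "traj_hitting K \<times> {0..u}"
  interpret sigma_finite_measure label_measure by (rule sigma_finite_label_measure)
  have cap: "capacity K \<ge> 0" by (auto simp: capacity_def intro!: sum_nonneg)
  have sets: "sets \<nu> = sets traj_space" using assms(1) by (simp add: interlacement_intensity_def)
  have lab: "{0..u} \<in> sets label_measure" by (auto simp: sets_restrict_space_iff)
  have B: "?B \<in> sets ?\<mu>" using traj_hitting_sets[OF assms(4)] lab sets by auto
  have em: "emeasure ?\<mu> ?B = ennreal (u * capacity K)"
    using traj_hitting_sets[OF assms(4)] lab sets assms cap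
    by (subst emeasure_pair_measure_Times)
       (auto simp: emeasure_traj_hitting emeasure_label_measure ennreal_mult[symmetric] mult.commute)
  then have m: "measure ?\<mu> ?B = u * capacity K" using cap assms(3) by (simp add: measure_def)
  have sp: "space ?\<mu> = UNIV // time_shift \<times> {0..}"
    using sets_eq_imp_space_eq[OF sets] by (simp add: space_pair_measure space_traj_space)
  have "random_interlacement \<eta> u \<omega> \<inter> K = {} \<longleftrightarrow> num_points \<eta> ?B \<omega> = of_nat 0" if "\<omega> \<in> space M" for \<omega>
  proof -
    have "ran (\<eta> \<omega>) \<subseteq> UNIV // time_shift \<times> {0..}"
      using assms(2) that sp by (auto simp: poisson_point_process_def)
    then have *: "c \<in> UNIV // time_shift \<and> v \<ge> 0" if "\<eta> \<omega> i = Some (c, v)" for i c v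
      using that by (auto simp: ran_def)
    have "num_points \<eta> ?B \<omega> = 0 \<longleftrightarrow> {i. \<exists>p\<in>?B. \<eta> \<omega> i = Some p} = {}"
      unfolding num_points_def by (subst emeasure_count_space_eq_0) auto
    also have "\<dots> \<longleftrightarrow> random_interlacement \<eta> u \<omega> \<inter> K = {}"
      using * by (fastforce simp: random_interlacement_def traj_hitting_def)
    finally show ?thesis by simp
  qed
  then have "{\<omega>\<in>space M. random_interlacement \<eta> u \<omega> \<inter> K = {}} =
      {\<omega>\<in>space M. num_points \<eta> ?B \<omega> = of_nat 0}" by blast
  moreover have "measure M {\<omega>\<in>space M. num_points \<eta> ?B \<omega> = of_nat 0} =
      measure ?\<mu> ?B ^ 0 / fact 0 * exp (- measure ?\<mu> ?B)"
  proof -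
    have "emeasure ?\<mu> ?B < \<infinity>" using em by simp
    with assms(2) B show ?thesis unfolding poisson_point_process_def by blast
  qed
  ultimately show ?thesis using m by simp
qed


section \<open>Convergence in law\<close>

definition random_element :: "'\<omega> measure \<Rightarrow> 'a topology \<Rightarrow> ('\<omega> \<Rightarrow> 'a) \<Rightarrow> bool" where
  "random_element M T X \<longleftrightarrow> X \<in> M \<rightarrow>\<^sub>M sigma (topspace T) {U. openin T U}"

definition converges_in_law ::
    "'a topology \<Rightarrow> '\<omega> measure \<Rightarrow> (nat \<Rightarrow> '\<omega> \<Rightarrow> 'a) \<Rightarrow> '\<omega>' measure \<Rightarrow> ('\<omega>' \<Rightarrow> 'a) \<Rightarrow> bool" where
  "converges_in_law T M X M' Y \<longleftrightarrow>
     (\<forall>n. random_element M T (X n)) \<and> random_element M' T Y \<and>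
     (\<forall>f. continuous_map T euclideanreal f \<and> bounded (f ` topspace T) \<longrightarrow>
        (\<lambda>n. \<integral>\<omega>. f (X n \<omega>) \<partial>M) \<longlonglongrightarrow> (\<integral>\<omega>. f (Y \<omega>) \<partial>M'))"

text \<open>Random sets are viewed as \<open>bool\<close>-valued processes through \<open>\<lambda>z. z \<in> I \<omega>\<close>.\<close>

definition fdd_converges ::
    "'\<omega> measure \<Rightarrow> (nat \<Rightarrow> '\<omega> \<Rightarrow> 'z set) \<Rightarrow> '\<omega>' measure \<Rightarrow> ('\<omega>' \<Rightarrow> 'z set) \<Rightarrow> bool" where
  "fdd_converges M I M' J \<longleftrightarrow>
     (\<forall>F. finite F \<longrightarrow>
        converges_in_law (product_topology (\<lambda>_. discrete_topology (UNIV :: bool set)) F)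
          M (\<lambda>n \<omega>. \<lambda>z\<in>F. z \<in> I n \<omega>) M' (\<lambda>\<omega>. \<lambda>z\<in>F. z \<in> J \<omega>))"

end

theory Submission
  imports Defs
begin

text \<open>
  By inclusion-exclusion the finite-dimensional marginals of a random set are determined by its void
  probabilities, so it suffices that these converge. A trajectory that hits \<open>K\<close> before time \<open>L\<close> has a last
  visit to \<open>K\<close> in that time window. Since counting measure is invariant for the walk, summing over all
  starting points shows that the last visit happens at time \<open>n\<close> in \<open>y\<close> with mass
  \<open>P\<^sub>y[X\<^sub>1, \<dots>, X\<^bsub>L-n-1\<^esub> \<notin> K]\<close>. The intensity of the trajectories hitting \<open>K\<close> is therefore \<open>4du\<close> times a
  Cesaro mean of the numbers \<open>\<Sum>\<^bsub>y\<in>K\<^esub> P\<^sub>y[X\<^sub>1, \<dots>, X\<^sub>m \<notin> K]\<close>, which tends to \<open>u cap(K)\<close>.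
\<close>

section \<open>Void probabilities determine the finite-dimensional marginals\<close>

text \<open>Membership of a single point \<open>a\<close> is the complement of the void event of
  \<open>{a}\<close>, so these events come from finitely many void events.\<close>

lemma measurable_void_contains:
  assumes void: "\<And>C. finite C \<Longrightarrow> {\<omega>\<in>space M. I \<omega> \<inter> C = {}} \<in> sets M"
    and "finite C" "finite A"
  shows "{\<omega>\<in>space M. I \<omega> \<inter> C = {} \<and> A \<subseteq> I \<omega>} \<in> sets M"
proof -
  have "{\<omega>\<in>space M. I \<omega> \<inter> C = {} \<and> A \<subseteq> I \<omega>} =
      {\<omega>\<in>space M. I \<omega> \<inter> C = {}} - (\<Union>a\<in>A. {\<omega>\<in>space M. I \<omega> \<inter> {a} = {}})"
    by auto
  also have "\<dots> \<in> sets M"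
    using assms by (intro sets.Diff sets.finite_UN void) auto
  finally show ?thesis .
qed

text \<open>Inclusion-exclusion one point at a time: the probability of containing \<open>a\<close>
  is a difference of two probabilities that involve only \<open>A\<close>, one of them with
  \<open>a\<close> added to the void set. This is why \<open>C\<close> is arbitrary in the
  induction.\<close>

lemma void_contains_tendsto:
  fixes I :: "nat \<Rightarrow> 'v \<Rightarrow> 'z set" and J :: "'v' \<Rightarrow> 'z set"
  assumes "prob_space M" "prob_space M'"
    and void: "\<And>n C. finite C \<Longrightarrow> {\<omega>\<in>space M. I n \<omega> \<inter> C = {}} \<in> sets M"
    and void': "\<And>C. finite C \<Longrightarrow> {\<omega>\<in>space M'. J \<omega> \<inter> C = {}} \<in> sets M'"
    and lim: "\<And>C. finite C \<Longrightarrow> (\<lambda>n. measure M {\<omega>\<in>space M. I n \<omega> \<inter> C = {}})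
      \<longlonglongrightarrow> measure M' {\<omega>\<in>space M'. J \<omega> \<inter> C = {}}"
    and "finite A" "finite C"
  shows "(\<lambda>n. measure M {\<omega>\<in>space M. I n \<omega> \<inter> C = {} \<and> A \<subseteq> I n \<omega>})
      \<longlonglongrightarrow> measure M' {\<omega>\<in>space M'. J \<omega> \<inter> C = {} \<and> A \<subseteq> J \<omega>}"
  using \<open>finite A\<close> \<open>finite C\<close>
proof (induction A arbitrary: C)
  case empty
  then show ?case using lim by simp
next
  case (insert a A)
  \<comment> \<open>A separate sample space type lets this one identity serve both processes. For
    \<open>a \<in> C\<close> both sides are 0.\<close>
  have split: "measure N {\<omega>\<in>space N. H \<omega> \<inter> C = {} \<and> insert a A \<subseteq> H \<omega>} =
      measure N {\<omega>\<in>space N. H \<omega> \<inter> C = {} \<and> A \<subseteq> H \<omega>}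
      - measure N {\<omega>\<in>space N. H \<omega> \<inter> insert a C = {} \<and> A \<subseteq> H \<omega>}"
    if "prob_space N" "\<And>C. finite C \<Longrightarrow> {\<omega>\<in>space N. H \<omega> \<inter> C = {}} \<in> sets N"
    for N :: "'w measure" and H :: "'w \<Rightarrow> 'z set"
  proof -
    interpret prob_space N by fact
    have "{\<omega>\<in>space N. H \<omega> \<inter> C = {} \<and> insert a A \<subseteq> H \<omega>} =
      {\<omega>\<in>space N. H \<omega> \<inter> C = {} \<and> A \<subseteq> H \<omega>}
      - {\<omega>\<in>space N. H \<omega> \<inter> insert a C = {} \<and> A \<subseteq> H \<omega>}"
      by auto
    then show ?thesis
      using insert.hyps(1) insert.prems that(2)
      by (simp only:) (intro finite_measure_Diff measurable_void_contains; auto)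
  qed
  show ?case
    using insert.prems
    by (simp only: split assms(1,2) void void') (intro tendsto_diff insert.IH; simp)
qed

text \<open>A marginal on a finite \<open>F\<close> takes finitely many values, one for each trace
  \<open>A \<subseteq> F\<close> of the random set. Hence measurability and expectations reduce to
  the trace events.\<close>

lemma fdd_converges_void:
  fixes I :: "nat \<Rightarrow> 'w \<Rightarrow> 'z set" and J :: "'w' \<Rightarrow> 'z set"
  assumes "prob_space M" "prob_space M'"
    and void: "\<And>n C. finite C \<Longrightarrow> {\<omega>\<in>space M. I n \<omega> \<inter> C = {}} \<in> sets M"
    and void': "\<And>C. finite C \<Longrightarrow> {\<omega>\<in>space M'. J \<omega> \<inter> C = {}} \<in> sets M'"
    and lim: "\<And>C. finite C \<Longrightarrow> (\<lambda>n. measure M {\<omega>\<in>space M. I n \<omega> \<inter> C = {}})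
      \<longlonglongrightarrow> measure M' {\<omega>\<in>space M'. J \<omega> \<inter> C = {}}"
  shows "fdd_converges M I M' J"
  unfolding fdd_converges_def converges_in_law_def
proof (intro allI impI conjI)
  fix F :: "'z set" assume F: "finite F"
  let ?T = "product_topology (\<lambda>_. discrete_topology (UNIV :: bool set)) F"
  \<comment> \<open>This form of a trace event is the one that the two preceding lemmas
    handle.\<close>
  have event: "{\<omega>\<in>space N. H \<omega> \<inter> F = A} = {\<omega>\<in>space N. H \<omega> \<inter> (F - A) = {} \<and> A \<subseteq> H \<omega>}"
    if "A \<subseteq> F" for N :: "'v measure" and H and A :: "'z set"
    using that by auto
  have event_sets: "{\<omega>\<in>space N. H \<omega> \<inter> F = A} \<in> sets N"
    if "A \<subseteq> F" "\<And>C. finite C \<Longrightarrow> {\<omega>\<in>space N. H \<omega> \<inter> C = {}} \<in> sets N"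
    for N :: "'v measure" and H and A :: "'z set"
    using that F by (simp only: event) (intro measurable_void_contains; auto intro: finite_subset)
  have restrict_eq: "(\<lambda>z\<in>F. z \<in> B) = (\<lambda>z\<in>F. z \<in> B \<inter> F)" for B :: "'z set"
    by auto
  have element: "random_element N ?T (\<lambda>\<omega>. \<lambda>z\<in>F. z \<in> H \<omega>)"
    if H: "\<And>C. finite C \<Longrightarrow> {\<omega>\<in>space N. H \<omega> \<inter> C = {}} \<in> sets N"
    for N :: "'v measure" and H
    unfolding random_element_def
  proof (rule measurable_measure_of)
    show "{U. openin ?T U} \<subseteq> Pow (topspace ?T)"
      using openin_subset by blast
    show "(\<lambda>\<omega>. \<lambda>z\<in>F. z \<in> H \<omega>) \<in> space N \<rightarrow> topspace ?T"
      by auto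
    fix U
    \<comment> \<open>Any preimage is a finite union of trace events.\<close>
    have "(\<lambda>\<omega>. \<lambda>z\<in>F. z \<in> H \<omega>) -` U \<inter> space N =
        (\<Union>A\<in>{A\<in>Pow F. (\<lambda>z\<in>F. z \<in> A) \<in> U}. {\<omega>\<in>space N. H \<omega> \<inter> F = A})"
      using restrict_eq by auto
    also have "\<dots> \<in> sets N"
      using F H by (intro sets.finite_UN event_sets) auto
    finally show "(\<lambda>\<omega>. \<lambda>z\<in>F. z \<in> H \<omega>) -` U \<inter> space N \<in> sets N" .
  qed
  show "random_element M ?T (\<lambda>\<omega>. \<lambda>z\<in>F. z \<in> I n \<omega>)" for n
    by (rule element) (rule void)
  show "random_element M' ?T (\<lambda>\<omega>. \<lambda>z\<in>F. z \<in> J \<omega>)"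
    by (rule element) (rule void')
  fix f :: "('z \<Rightarrow> bool) \<Rightarrow> real"
  \<comment> \<open>The expectation is a finite linear combination of trace probabilities, so its
    limit can be taken term by term.\<close>
  have expectation: "(\<integral>\<omega>. f (\<lambda>z\<in>F. z \<in> H \<omega>) \<partial>N) =
      (\<Sum>A\<in>Pow F. f (\<lambda>z\<in>F. z \<in> A) * measure N {\<omega>\<in>space N. H \<omega> \<inter> (F - A) = {} \<and> A \<subseteq> H \<omega>})"
    if "prob_space N" and H: "\<And>C. finite C \<Longrightarrow> {\<omega>\<in>space N. H \<omega> \<inter> C = {}} \<in> sets N"
    for N :: "'v measure" and H
  proof -
    interpret prob_space N by fact
    have "f (\<lambda>z\<in>F. z \<in> H \<omega>) =
        (\<Sum>A\<in>Pow F. f (\<lambda>z\<in>F. z \<in> A) * indicator {\<omega>\<in>space N. H \<omega> \<inter> F = A} \<omega>)"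
      if "\<omega> \<in> space N" for \<omega>
    proof -
      have "(\<Sum>A\<in>Pow F. f (\<lambda>z\<in>F. z \<in> A) * indicator {\<omega>\<in>space N. H \<omega> \<inter> F = A} \<omega>) =
          (\<Sum>A\<in>Pow F. if A = H \<omega> \<inter> F then f (\<lambda>z\<in>F. z \<in> A) else 0)"
        using that by (intro sum.cong) (auto simp: indicator_def)
      also have "\<dots> = f (\<lambda>z\<in>F. z \<in> H \<omega>)"
        using F restrict_eq[of "H \<omega>"] by (subst sum.delta) auto
      finally show ?thesis by simp
    qed
    then have "(\<integral>\<omega>. f (\<lambda>z\<in>F. z \<in> H \<omega>) \<partial>N) =
        (\<integral>\<omega>. (\<Sum>A\<in>Pow F. f (\<lambda>z\<in>F. z \<in> A) * indicator {\<omega>\<in>space N. H \<omega> \<inter> F = A} \<omega>) \<partial>N)"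
      by (intro Bochner_Integration.integral_cong) auto
    also have "\<dots> = (\<Sum>A\<in>Pow F. f (\<lambda>z\<in>F. z \<in> A) * measure N {\<omega>\<in>space N. H \<omega> \<inter> F = A})"
    proof -
      have A: "{\<omega>\<in>space N. H \<omega> \<inter> F = A} \<in> sets N" if "A \<in> Pow F" for A
        using that H by (intro event_sets) auto
      then have "integrable N (indicator {\<omega>\<in>space N. H \<omega> \<inter> F = A} :: _ \<Rightarrow> real)" if "A \<in> Pow F" for A
        using that by (simp add: emeasure_eq_measure)
      then show ?thesis
        using A by (subst Bochner_Integration.integral_sum)
          (auto intro!: sum.cong arg_cong2[where f="(*)"] arg_cong[where f="measure N"])
    qed
    also have "\<dots> = (\<Sum>A\<in>Pow F. f (\<lambda>z\<in>F. z \<in> A) *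
        measure N {\<omega>\<in>space N. H \<omega> \<inter> (F - A) = {} \<and> A \<subseteq> H \<omega>})"
      by (intro sum.cong refl) (simp add: event)
    finally show ?thesis .
  qed
  show "(\<lambda>n. \<integral>\<omega>. f (\<lambda>z\<in>F. z \<in> I n \<omega>) \<partial>M) \<longlonglongrightarrow> (\<integral>\<omega>. f (\<lambda>z\<in>F. z \<in> J \<omega>) \<partial>M')"
    using F
    by (simp only: expectation assms(1,2) void void')
      (intro tendsto_sum tendsto_mult tendsto_const void_contains_tendsto assms;
        auto intro: finite_subset)
qed


section \<open>Void probabilities of Poisson processes\<close>

lemma num_points_eq_0_iff: "num_points \<eta> B \<omega> = 0 \<longleftrightarrow> ran (\<eta> \<omega>) \<inter> B = {}"
  unfolding num_points_def by (subst emeasure_count_space_eq_0) (auto simp: ran_def)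

lemma measurable_poisson_void:
  assumes "poisson_point_process M \<mu> \<eta>" "B \<in> sets \<mu>"
  shows "{\<omega>\<in>space M. ran (\<eta> \<omega>) \<inter> B = {}} \<in> sets M"
proof -
  have [measurable]: "num_points \<eta> B \<in> borel_measurable M"
    using assms by (auto simp: poisson_point_process_def)
  have "{\<omega>\<in>space M. num_points \<eta> B \<omega> = 0} \<in> sets M" by measurable
  then show ?thesis by (simp add: num_points_eq_0_iff)
qed

lemma measure_poisson_void:
  assumes "poisson_point_process M \<mu> \<eta>" "B \<in> sets \<mu>" "emeasure \<mu> B < \<infinity>"
  shows "measure M {\<omega>\<in>space M. ran (\<eta> \<omega>) \<inter> B = {}} = exp (- measure \<mu> B)"
proof -
  \<comment> \<open>The Poisson weight at \<open>k = 0\<close>.\<close>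
  have "measure M {\<omega>\<in>space M. num_points \<eta> B \<omega> = of_nat 0} =
      measure \<mu> B ^ 0 / fact 0 * exp (- measure \<mu> B)"
    using assms unfolding poisson_point_process_def by blast
  then show ?thesis by (simp add: num_points_eq_0_iff)
qed

text \<open>Supplements \<open>random_interlacement_void_probability\<close>, which states only the
  probability of this event.\<close>

lemma measurable_random_interlacement_void:
  assumes "sets \<nu> = sets traj_space" "poisson_point_process M (\<nu> \<Otimes>\<^sub>M label_measure) \<eta>"
    and "finite K"
  shows "{\<omega>\<in>space M. random_interlacement \<eta> u \<omega> \<inter> K = {}} \<in> sets M"
proof -
  let ?\<mu> = "\<nu> \<Otimes>\<^sub>M label_measure"
  let ?B = "traj_hitting K \<times> {0..u}"
  have "{0..u} \<in> sets label_measure" by (auto simp: sets_restrict_space_iff)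
  then have B: "?B \<in> sets ?\<mu>" using traj_hitting_sets[OF assms(3)] assms(1) by auto
  have sp: "space ?\<mu> = UNIV // time_shift \<times> {0..}"
    using sets_eq_imp_space_eq[OF assms(1)] by (simp add: space_pair_measure space_traj_space)
  have "random_interlacement \<eta> u \<omega> \<inter> K = {} \<longleftrightarrow> ran (\<eta> \<omega>) \<inter> ?B = {}" if "\<omega> \<in> space M" for \<omega>
  proof -
    have "ran (\<eta> \<omega>) \<subseteq> UNIV // time_shift \<times> {0..}"
      using assms(2) that sp by (auto simp: poisson_point_process_def)
    \<comment> \<open>Points lie in the space of the intensity, so labels are nonnegative and
      \<open>v \<le> u\<close> means \<open>v \<in> {0..u}\<close>.\<close>
    then have "c \<in> UNIV // time_shift \<and> v \<ge> 0" if "\<eta> \<omega> i = Some (c, v)" for i c v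
      using that by (auto simp: ran_def)
    then show ?thesis
      by (fastforce simp: random_interlacement_def traj_hitting_def ran_def)
  qed
  then have "{\<omega>\<in>space M. random_interlacement \<eta> u \<omega> \<inter> K = {}} =
      {\<omega>\<in>space M. ran (\<eta> \<omega>) \<inter> ?B = {}}" by blast
  with measurable_poisson_void[OF assms(2) B] show ?thesis by simp
qed


section \<open>Last visits of the walk\<close>

text \<open>Reindexing an i.i.d. sequence along the injection \<open>k \<mapsto> n + k\<close>
  preserves its law. Applied to the increments, this gives the Markov property at time
  \<open>n\<close>.\<close>

lemma distr_shift_sequence:
  assumes "prob_space N"
  shows "distr (\<Pi>\<^sub>M k\<in>(UNIV::nat set). N) (\<Pi>\<^sub>M k\<in>UNIV. N) (\<lambda>\<xi> k. \<xi> (n + k)) = (\<Pi>\<^sub>M k\<in>UNIV. N)"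
  using distr_PiM_reindex[of UNIV "\<lambda>_. N" "\<lambda>k. n + k" UNIV] assms
  by (simp add: restrict_def)

text \<open>A general time set covers the window \<open>{..<L}\<close> of a finite trajectory, the
  times \<open>{n<..<L}\<close> after a visit, and \<open>no_return K\<close> as the case
  \<open>T = {1..}\<close>.\<close>

definition avoids :: "'a set \<Rightarrow> nat set \<Rightarrow> (nat \<Rightarrow> 'a) set" where
  "avoids K T = {w. \<forall>k\<in>T. w k \<notin> K}"

lemma measurable_avoids [measurable]: "avoids K T \<in> sets path_space"
proof -
  have "avoids K T = {w \<in> space path_space. \<forall>k\<in>T. w k \<notin> K}"
    by (auto simp: avoids_def)
  also have "\<dots> \<in> sets path_space" by measurable
  finally show ?thesis .
qed

lemma measurable_visit_avoids: "{w. w n = y} \<inter> avoids K T \<in> sets path_space"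
proof -
  have "{w. w n = y} = {w \<in> space path_space. w n = y}" by simp
  also have "\<dots> \<in> sets path_space" by measurable
  finally show ?thesis by (intro sets.Int measurable_avoids)
qed

text \<open>On the space of increments the law is the same for all starting points, so that the sum
  over \<open>x\<close> can later be moved inside the integral.\<close>

lemma emeasure_lazy_walk:
  fixes x :: "int ^ 'd"
  assumes "A \<in> sets path_space"
  shows "emeasure (lazy_walk x) A =
    (\<integral>\<^sup>+\<xi>. indicator A (\<lambda>n. x + (\<Sum>k<n. \<xi> k)) \<partial>(\<Pi>\<^sub>M n\<in>UNIV. measure_pmf lazy_step))"
proof -
  have "emeasure (lazy_walk x) A = (\<integral>\<^sup>+w. indicator A w \<partial>lazy_walk x)"
    using assms by simp
  also have "\<dots> = (\<integral>\<^sup>+\<xi>. indicator A (\<lambda>n. x + (\<Sum>k<n. \<xi> k)) \<partial>(\<Pi>\<^sub>M n\<in>UNIV. measure_pmf lazy_step))"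
    unfolding lazy_walk_def
    using assms by (intro nn_integral_distr measurable_partial_sums) simp
  finally show ?thesis .
qed

text \<open>For fixed increments exactly one starting point leads to \<open>y\<close> at time
  \<open>n\<close>: this is the invariance of counting measure. The remaining path is a walk from
  \<open>y\<close> driven by the shifted increments.\<close>

lemma emeasure_last_visit:
  fixes y :: "int ^ 'd"
  assumes "n < L"
  shows "emeasure (count_space UNIV \<bind> lazy_walk) ({w. w n = y} \<inter> avoids K {n<..<L}) =
    emeasure (lazy_walk y) (avoids K {1..<L - n})"
proof -
  let ?A = "{w. w n = y} \<inter> avoids K {n<..<L}"
  let ?B = "avoids K {1..<L - n}"
  let ?S = "\<Pi>\<^sub>M n\<in>(UNIV::nat set). measure_pmf (lazy_step :: (int ^ 'd) pmf)"
  let ?X = "\<lambda>x (\<xi> :: nat \<Rightarrow> int ^ 'd) n. x + (\<Sum>k<n. \<xi> k)"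
  have A: "?A \<in> sets path_space" by (rule measurable_visit_avoids)
  have meas: "(\<lambda>\<xi>. indicator D (?X x \<xi>) :: ennreal) \<in> borel_measurable ?S"
    if "D \<in> sets path_space" for D x
    using that by (intro measurable_compose[OF measurable_partial_sums]) auto
  have shift: "indicator ?A (?X x \<xi>) =
      (indicator {y - (\<Sum>k<n. \<xi> k)} x * indicator ?B (?X y (\<lambda>k. \<xi> (n + k))) :: ennreal)" for x \<xi>
  proof -
    have sums: "(\<Sum>k<n + j. \<xi> k) = (\<Sum>k<n. \<xi> k) + (\<Sum>k<j. \<xi> (n + k))" for j
      by (induction j) (auto simp: algebra_simps)
    have times: "(\<forall>k\<in>{n<..<L}. P k) \<longleftrightarrow> (\<forall>j\<in>{1..<L - n}. P (n + j))" for P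
    proof safe
      fix k assume *: "\<forall>j\<in>{1..<L - n}. P (n + j)" "k \<in> {n<..<L}"
      then show "P k" by (auto dest!: bspec[of _ _ "k - n"])
    qed auto
    have "?X x \<xi> (n + j) = ?X y (\<lambda>k. \<xi> (n + k)) j" if "x = y - (\<Sum>k<n. \<xi> k)" for j
      using that by (simp add: sums)
    then have "?X x \<xi> \<in> ?A \<longleftrightarrow> x = y - (\<Sum>k<n. \<xi> k) \<and> ?X y (\<lambda>k. \<xi> (n + k)) \<in> ?B"
      unfolding avoids_def Int_iff mem_Collect_eq times by (auto simp: algebra_simps)
    then show ?thesis by (simp add: indicator_def)
  qed
  have "emeasure (count_space UNIV \<bind> lazy_walk) ?A =
      (\<integral>\<^sup>+x. \<integral>\<^sup>+\<xi>. indicator ?A (?X x \<xi>) \<partial>?S \<partial>count_space UNIV)"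
    by (simp only: emeasure_bind_lazy_walk[OF A] emeasure_lazy_walk[OF A])
  \<comment> \<open>Tonelli over the countable lattice.\<close>
  also have "\<dots> = (\<integral>\<^sup>+\<xi>. \<integral>\<^sup>+x. indicator ?A (?X x \<xi>) \<partial>count_space UNIV \<partial>?S)"
    by (rule nn_integral_count_space_nn_integral[symmetric]) (auto intro: meas A)
  also have "\<dots> = (\<integral>\<^sup>+\<xi>. indicator ?B (?X y (\<lambda>k. \<xi> (n + k))) \<partial>?S)"
  proof (intro nn_integral_cong)
    fix \<xi>
    show "(\<integral>\<^sup>+x. indicator ?A (?X x \<xi>) \<partial>count_space UNIV) =
        (indicator ?B (?X y (\<lambda>k. \<xi> (n + k))) :: ennreal)"
      \<comment> \<open>The single admissible starting point has counting measure 1.\<close>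
      unfolding shift by (subst nn_integral_multc) auto
  qed
  also have "\<dots> = (\<integral>\<^sup>+\<xi>. indicator ?B (?X y \<xi>) \<partial>distr ?S ?S (\<lambda>\<xi> k. \<xi> (n + k)))"
  proof (intro nn_integral_distr[symmetric] meas measurable_avoids measurable_PiM_single')
    show "(\<lambda>\<xi>. \<xi> (n + k)) \<in> ?S \<rightarrow>\<^sub>M measure_pmf lazy_step" for k
      by (rule measurable_component_singleton) simp
  qed (auto simp: space_PiM)
  also have "\<dots> = emeasure (lazy_walk y) ?B"
    by (simp only: distr_shift_sequence[OF prob_space_measure_pmf] emeasure_lazy_walk[OF measurable_avoids])
  finally show ?thesis .
qed

text \<open>Finite-time analogue of \<open>capacity K / (4d)\<close>. For \<open>m = 0\<close> there
  is no constraint.\<close>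

definition escape_mass :: "(int ^ 'd) set \<Rightarrow> nat \<Rightarrow> real" where
  "escape_mass K m = (\<Sum>y\<in>K. measure (lazy_walk y) (avoids K {1..m}))"

text \<open>The hitting event splits disjointly by the time \<open>n\<close> and the place
  \<open>y\<close> of the last visit to \<open>K\<close> before \<open>L\<close>.\<close>

lemma emeasure_hitting:
  fixes K :: "(int ^ 'd) set"
  assumes "finite K"
  shows "emeasure (count_space UNIV \<bind> lazy_walk) (UNIV - avoids K {..<L}) =
    ennreal (\<Sum>m<L. escape_mass K m)"
proof -
  let ?\<mu> = "count_space UNIV \<bind> lazy_walk :: (nat \<Rightarrow> int ^ 'd) measure"
  let ?A = "\<lambda>(n, y). {w. w n = y} \<inter> avoids K {n<..<L}"
  have disj: "disjoint_family_on ?A ({..<L} \<times> K)"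
    unfolding disjoint_family_on_def
  proof (intro ballI impI equals0I)
    fix p q w assume "p \<in> {..<L} \<times> K" "q \<in> {..<L} \<times> K" "p \<noteq> q" "w \<in> ?A p \<inter> ?A q"
    \<comment> \<open>At distinct times, the later visit violates the avoidance required after the
      earlier one; at equal times the positions differ.\<close>
    then show False
      by (cases "fst p" "fst q" rule: linorder_cases) (auto simp: avoids_def)
  qed
  have UN: "(\<Union>p\<in>{..<L} \<times> K. ?A p) = UNIV - avoids K {..<L}"
  proof safe
    fix w assume "w \<notin> avoids K {..<L}"
    then have ne: "{n. n < L \<and> w n \<in> K} \<noteq> {}" by (auto simp: avoids_def)
    define n where "n = Max {n. n < L \<and> w n \<in> K}"
    have "n < L" "w n \<in> K" using Max_in[OF _ ne] by (auto simp: n_def)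
    moreover have "k \<le> n" if "k < L" "w k \<in> K" for k
      using that by (auto simp: n_def)
    ultimately have "(n, w n) \<in> {..<L} \<times> K" "w \<in> ?A (n, w n)"
      by (force simp: avoids_def)+
    then show "w \<in> (\<Union>p\<in>{..<L} \<times> K. ?A p)" by (rule UN_I)
  qed (auto simp: avoids_def)
  have walk: "emeasure (lazy_walk y) D = ennreal (measure (lazy_walk y) D)" for y :: "int ^ 'd" and D
    by (rule finite_measure.emeasure_eq_measure)
      (rule prob_space.axioms(1)[OF prob_space_lazy_walk])
  have "emeasure ?\<mu> (UNIV - avoids K {..<L}) = (\<Sum>p\<in>{..<L} \<times> K. emeasure ?\<mu> (?A p))"
    unfolding UN[symmetric] using assms disj
    by (intro sum_emeasure[symmetric]) (auto intro: measurable_visit_avoids)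
  also have "\<dots> = (\<Sum>n<L. \<Sum>y\<in>K. emeasure ?\<mu> ({w. w n = y} \<inter> avoids K {n<..<L}))"
    by (simp add: sum.cartesian_product case_prod_beta)
  also have "\<dots> = (\<Sum>n<L. ennreal (escape_mass K (L - Suc n)))"
  proof (intro sum.cong refl)
    fix n assume "n \<in> {..<L}"
    \<comment> \<open>After a last visit at time \<open>n\<close>, \<open>L - Suc n\<close> times
      remain in the window; reversing the sum turns this number into \<open>m\<close>, running over
      \<open>{..<L}\<close>.\<close>
    then have "{1..<L - n} = {1..L - Suc n}" by auto
    then show "(\<Sum>y\<in>K. emeasure ?\<mu> ({w. w n = y} \<inter> avoids K {n<..<L})) =
        ennreal (escape_mass K (L - Suc n))"
      using \<open>n \<in> {..<L}\<close> by (simp add: emeasure_last_visit walk escape_mass_def sum_ennreal)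
  qed
  also have "\<dots> = (\<Sum>m<L. ennreal (escape_mass K m))"
    by (rule sum.nat_diff_reindex)
  also have "\<dots> = ennreal (\<Sum>m<L. escape_mass K m)"
    by (intro sum_ennreal) (auto simp: escape_mass_def intro: sum_nonneg)
  finally show ?thesis .
qed

section \<open>Limits of escape masses and of their averages\<close>

lemma escape_mass_tendsto:
  fixes K :: "(int ^ 'd) set"
  shows "escape_mass K \<longlonglongrightarrow> (\<Sum>y\<in>K. measure (lazy_walk y) (no_return K))"
  unfolding escape_mass_def
proof (intro tendsto_sum)
  fix y :: "int ^ 'd"
  interpret prob_space "lazy_walk y" by (rule prob_space_lazy_walk)
  \<comment> \<open>Continuity from above, as the events decrease in \<open>m\<close>.\<close>
  have "(\<lambda>m. measure (lazy_walk y) (avoids K {1..m})) \<longlonglongrightarrow> measure (lazy_walk y) (\<Inter>m. avoids K {1..m})"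
    by (rule finite_Lim_measure_decseq)
      (auto intro: measurable_avoids, auto simp: decseq_def avoids_def)
  also have "(\<Inter>m. avoids K {1..m}) = no_return K"
    by (force simp: avoids_def no_return_def)
  finally show "(\<lambda>m. measure (lazy_walk y) (avoids K {1..m})) \<longlonglongrightarrow> measure (lazy_walk y) (no_return K)" .
qed

lemma cesaro_mean_tendsto:
  fixes a :: "nat \<Rightarrow> real"
  assumes "a \<longlonglongrightarrow> l"
  shows "(\<lambda>n. (\<Sum>k<n. a k) / real n) \<longlonglongrightarrow> l"
proof (rule LIMSEQ_I)
  fix e :: real assume "e > 0"
  then obtain N where N: "\<bar>a k - l\<bar> < e / 2" if "k \<ge> N" for k
    using LIMSEQ_D[OF assms, of "e / 2"] by auto
  \<comment> \<open>\<open>C\<close> bounds the contribution of the first \<open>N\<close> terms for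
    every \<open>n\<close>; the choice of \<open>n0\<close> makes \<open>C / n\<close> smaller than
    \<open>e / 2\<close>.\<close>
  define C where "C = (\<Sum>k<N. \<bar>a k - l\<bar>)"
  have "C \<ge> 0" by (auto simp: C_def intro: sum_nonneg)
  obtain n0 where n0: "real n0 > 2 * C / e" using reals_Archimedean2 by blast
  have "norm ((\<Sum>k<n. a k) / real n - l) < e" if n: "n \<ge> Suc (max N n0)" for n
  proof -
    have "n > 0" using n by auto
    have "(\<Sum>k<n. a k) / real n - l = (\<Sum>k<n. a k - l) / real n"
      using \<open>n > 0\<close> by (simp add: sum_subtractf field_simps)
    moreover have "\<bar>\<Sum>k<n. a k - l\<bar> \<le> C + real n * (e / 2)"
    proof -
      have "\<bar>\<Sum>k<n. a k - l\<bar> \<le> (\<Sum>k<n. \<bar>a k - l\<bar>)" by (rule sum_abs)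
      also have "\<dots> = C + (\<Sum>k=N..<n. \<bar>a k - l\<bar>)"
        using n unfolding C_def
          by (subst sum.atLeastLessThan_concat[of 0 N n, symmetric, simplified atLeast0LessThan]) auto
      also have "(\<Sum>k=N..<n. \<bar>a k - l\<bar>) \<le> (\<Sum>k=N..<n. e / 2)"
        using N by (intro sum_mono) (auto intro: less_imp_le)
      also have "\<dots> \<le> real n * (e / 2)"
        using \<open>e > 0\<close> by (simp add: mult_right_mono)
      finally show ?thesis by simp
    qed
    moreover have "C < real n * (e / 2)"
    proof -
      have "2 * C / e < real n" using n0 n by linarith
      then show ?thesis using \<open>e > 0\<close> by (simp add: field_simps)
    qed
    ultimately show ?thesis using \<open>n > 0\<close> by (simp add: field_simps)
  qed
  then show "\<exists>n0. \<forall>n\<ge>n0. norm ((\<Sum>k<n. a k) / real n - l) < e" by blast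
qed


section \<open>Void probabilities of finite range interlacements\<close>

text \<open>\<open>K\<close> is missed exactly when no Poisson point falls into the product of the
  hitting event with the label interval, a set whose mass \<open>emeasure_hitting\<close>
  computes.\<close>

lemma finite_range_void:
  fixes \<eta> :: "'a \<Rightarrow> nat \<rightharpoonup> (nat \<Rightarrow> int ^ 'd) \<times> real"
  assumes ppp: "poisson_point_process M finite_range_intensity \<eta>"
    and "u \<ge> 0" "finite K"
  shows "{\<omega>\<in>space M. finite_range_interlacement \<eta> u L \<omega> \<inter> K = {}} \<in> sets M" (is ?S)
    and "measure M {\<omega>\<in>space M. finite_range_interlacement \<eta> u L \<omega> \<inter> K = {}} =
      exp (- (4 * real CARD('d) * u * ((\<Sum>m<L. escape_mass K m) / real L)))" (is ?P)
proof -
  \<comment> \<open>For \<open>L = 0\<close> division by zero gives \<open>v = 0\<close>, and the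
    claimed probability is 1, as it should be for empty ranges.\<close>
  define v where "v = 4 * real CARD('d) * u / real L"
  have v: "v \<ge> 0" using \<open>u \<ge> 0\<close> by (simp add: v_def)
  let ?\<mu> = "finite_range_intensity :: ((nat \<Rightarrow> int ^ 'd) \<times> real) measure"
  let ?A = "UNIV - avoids K {..<L} :: (nat \<Rightarrow> int ^ 'd) set"
  have A: "?A \<in> sets path_space"
    using sets.compl_sets[OF measurable_avoids] by simp
  have "{0..v} \<in> sets label_measure" by (auto simp: sets_restrict_space_iff)
  with A have B: "?A \<times> {0..v} \<in> sets ?\<mu>" by (simp add: finite_range_intensity_def)
  have nonneg: "(\<Sum>m<L. escape_mass K m) \<ge> 0"
    by (auto simp: escape_mass_def intro!: sum_nonneg)
  have em: "emeasure ?\<mu> (?A \<times> {0..v}) = ennreal (v * (\<Sum>m<L. escape_mass K m))"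
    using emeasure_finite_range_intensity[OF A v] emeasure_hitting[OF \<open>finite K\<close>, of L] v nonneg
    by (simp add: emeasure_bind_lazy_walk[OF A, symmetric] ennreal_mult)
  have "finite_range_interlacement \<eta> u L \<omega> \<inter> K = {} \<longleftrightarrow> ran (\<eta> \<omega>) \<inter> ?A \<times> {0..v} = {}"
    if "\<omega> \<in> space M" for \<omega>
  proof -
    have "ran (\<eta> \<omega>) \<subseteq> space ?\<mu>"
      using ppp that by (auto simp: poisson_point_process_def)
    then have label: "s \<ge> 0" if "\<eta> \<omega> i = Some (w, s)" for i w s
      using that by (auto simp: ran_def finite_range_intensity_def space_pair_measure)
    have "finite_range_interlacement \<eta> u L \<omega> \<inter> K = {} \<longleftrightarrow>
        (\<forall>i w s. \<eta> \<omega> i = Some (w, s) \<and> s \<le> v \<longrightarrow> w \<in> avoids K {..<L})"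
      unfolding finite_range_interlacement_def v_def avoids_def by fast
    also have "\<dots> \<longleftrightarrow> ran (\<eta> \<omega>) \<inter> ?A \<times> {0..v} = {}"
      using label by (fastforce simp: ran_def)
    finally show ?thesis .
  qed
  then have eq: "{\<omega>\<in>space M. finite_range_interlacement \<eta> u L \<omega> \<inter> K = {}} =
      {\<omega>\<in>space M. ran (\<eta> \<omega>) \<inter> ?A \<times> {0..v} = {}}" by blast
  show ?S unfolding eq by (rule measurable_poisson_void[OF ppp B])
  have "measure M {\<omega>\<in>space M. ran (\<eta> \<omega>) \<inter> ?A \<times> {0..v} = {}} = exp (- (v * (\<Sum>m<L. escape_mass K m)))"
    using measure_poisson_void[OF ppp B] em v nonneg by (simp add: measure_def)
  then show ?P unfolding eq by (simp add: v_def)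
qed

theorem proposition3p6:
  fixes M :: "'a measure" and M' :: "'b measure"
    and \<eta> :: "'a \<Rightarrow> nat \<rightharpoonup> (nat \<Rightarrow> int ^ 'd) \<times> real"
    and \<eta>' :: "'b \<Rightarrow> nat \<rightharpoonup> (int \<Rightarrow> int ^ 'd) set \<times> real"
    and \<nu> :: "(int \<Rightarrow> int ^ 'd) set measure"
    and u :: real
  assumes "CARD('d) \<ge> 3"
    and "poisson_point_process M finite_range_intensity \<eta>"
    and "interlacement_intensity \<nu>"
    and "poisson_point_process M' (\<nu> \<Otimes>\<^sub>M label_measure) \<eta>'"
    and "u \<ge> 0"
  shows "fdd_converges M (\<lambda>L. finite_range_interlacement \<eta> u L) M' (random_interlacement \<eta>' u)"
proof (rule fdd_converges_void)
  show "prob_space M" "prob_space M'"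
    using assms(2,4) by (simp_all add: poisson_point_process_def)
  fix K :: "(int ^ 'd) set" assume K: "finite K"
  show "{\<omega>\<in>space M. finite_range_interlacement \<eta> u L \<omega> \<inter> K = {}} \<in> sets M" for L
    using assms K by (intro finite_range_void)
  show "{\<omega>\<in>space M'. random_interlacement \<eta>' u \<omega> \<inter> K = {}} \<in> sets M'"
    using assms K by (intro measurable_random_interlacement_void) (auto simp: interlacement_intensity_def)
  \<comment> \<open>The sum of escape masses over \<open>L\<close> is a Cesaro mean, the
    \<open>1 / L\<close> coming from the label threshold.\<close>
  have "(\<lambda>L. exp (- (4 * real CARD('d) * u * ((\<Sum>m<L. escape_mass K m) / real L))))
      \<longlonglongrightarrow> exp (- (4 * real CARD('d) * u * (\<Sum>y\<in>K. measure (lazy_walk y) (no_return K))))"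
    by (intro tendsto_intros cesaro_mean_tendsto escape_mass_tendsto)
  \<comment> \<open>The factor \<open>4d\<close> of the label threshold becomes the vertex weight in
    the capacity.\<close>
  also have "4 * real CARD('d) * u * (\<Sum>y\<in>K. measure (lazy_walk y) (no_return K)) = u * capacity K"
    by (simp add: capacity_def sum_distrib_left mult_ac)
  finally show "(\<lambda>L. measure M {\<omega>\<in>space M. finite_range_interlacement \<eta> u L \<omega> \<inter> K = {}})
      \<longlonglongrightarrow> measure M' {\<omega>\<in>space M'. random_interlacement \<eta>' u \<omega> \<inter> K = {}}"
    using finite_range_void(2)[OF assms(2,5) K] random_interlacement_void_probability[OF assms(3,4,5) K]
    by simp
qed

end
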